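(* Let $K\ge2$ and let $\mathcal{P}=(p_{i,j})_{1\le i,j\le K}$ be an irreducible transition (stochastic) matrix with $p_{i,i}=0$ for all $i$. Let $\alpha_{i,n}\in(0,1)$ for $1\le i\le K$ and $n\in\mathbb{N}^*\cup\{\infty\}$, and let $(X_n,M_n)_{n\ge0}$ be the Markov chain on $\{a_1,\ldots,a_K\}\times(\mathbb{N}^*\cup\{\infty\})$ described in the context. (i) The chain $(X_n,M_n)_{n\ge 0}$ admits an invariant probability measure $\nu$ on $\{a_1,\ldots,a_K\}\times(\mathbb{N}^*\cup\{\infty\})$ if and only if $\Theta_1,\ldots,\Theta_K$ are all finite. This invariant probability measure is unique. (ii) Moreover, let $v^*=(v_1^*,\ldots,v_K^* )$ be the positive vector, unique up to a positive multiplicative constant, such that ${}^t\mathcal{P}v^*=v^*$ (given by the Frobenius theorem for the largest eigenvalue $1$). Then $\nu(a_i,\infty)=0$ for all $1\le i\le K$ and, for all $1\le i\le K$ and $n\ge1$, $$\nu(a_i,n)=\frac{v_i^*}{\langle\Theta,v^*\rangle}\,\mathcal{P}_i(n),\qquad\text{where }\langle\Theta,v^*\rangle=\sum_{i=1}^K\Theta_iv_i^*.$$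
   Context: $\mathbb{N}^*=\{1,2,\ldots\}$. The chain has transition probabilities, for $1\le i\neq j\le K$ and $n\in\mathbb{N}^*$: $Q((a_i,n),(a_i,n+1))=1-\alpha_{i,n}$, $\;Q((a_i,n),(a_j,1))=\alpha_{i,n}p_{i,j}$, $\;Q((a_i,\infty),(a_i,\infty))=1-\alpha_{i,\infty}$, $\;Q((a_i,\infty),(a_j,1))=\alpha_{i,\infty}p_{i,j}$. For $m\ge1$, $\mathcal{P}_i(m)=\prod_{k=1}^{m-1}(1-\alpha_{i,k})$ (empty product equal to $1$), and $\Theta_i=\sum_{n\ge1}\mathcal{P}_i(n)=\sum_{n\ge1}\prod_{k=1}^{n-1}(1-\alpha_{i,k})\in[1,\infty]$. *)

theory Defs
  imports "HOL-Probability.Probability"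
begin

definition stochastic_matrix :: "real ^ 'k ^ 'k \<Rightarrow> bool" where
  "stochastic_matrix P \<longleftrightarrow> (\<forall>i j. 0 \<le> P $ i $ j) \<and> (\<forall>i. (\<Sum>j\<in>UNIV. P $ i $ j) = 1)"

(* The power operator on vectors is componentwise, so matrix powers are written as
   iterated matrix products. *)
definition irreducible_matrix :: "real ^ 'k ^ 'k \<Rightarrow> bool" where
  "irreducible_matrix P \<longleftrightarrow> (\<forall>i j. \<exists>n. 0 < (((**) P ^^ n) (mat 1)) $ i $ j)"

(* The letter a_i is identified with the index i, and the positive integers together with
   infinity with the extended naturals that are at least 1. *)
definition chain_states :: "('k \<times> enat) set" where
  "chain_states = UNIV \<times> {1..}"

(* For n = \<infinity> the target (i, n + 1) of the first branch is (i, \<infinity>) itself. *)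
fun chain_kernel ::
    "real ^ 'k ^ 'k \<Rightarrow> ('k \<Rightarrow> enat \<Rightarrow> real) \<Rightarrow> 'k \<times> enat \<Rightarrow> 'k \<times> enat \<Rightarrow> real" where
  "chain_kernel P \<alpha> (i, n) (j, m) =
     (if j = i \<and> m = n + 1 then 1 - \<alpha> i n
      else if j \<noteq> i \<and> m = 1 then \<alpha> i n * P $ i $ j
      else 0)"

(* As the state space is countable, a probability measure on S is given by its mass function. *)
definition invariant_probability :: "'s set \<Rightarrow> ('s \<Rightarrow> 's \<Rightarrow> real) \<Rightarrow> 's pmf \<Rightarrow> bool" where
  "invariant_probability S Q \<nu> \<longleftrightarrow>
     set_pmf \<nu> \<subseteq> S \<and> (\<forall>y\<in>S. ((\<lambda>x. pmf \<nu> x * Q x y) has_sum pmf \<nu> y) S)"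

definition survival :: "('k \<Rightarrow> enat \<Rightarrow> real) \<Rightarrow> 'k \<Rightarrow> nat \<Rightarrow> real" where
  "survival \<alpha> i m = (\<Prod>k\<in>{1..<m}. 1 - \<alpha> i (enat k))"

(* suminf starts at 0, whereas the series runs over the positive integers. *)
definition Theta :: "('k \<Rightarrow> enat \<Rightarrow> real) \<Rightarrow> 'k \<Rightarrow> ennreal" where
  "Theta \<alpha> i = (\<Sum>n. ennreal (survival \<alpha> i (Suc n)))"

definition positive_fixed_vector :: "real ^ 'k ^ 'k \<Rightarrow> real ^ 'k \<Rightarrow> bool" where
  "positive_fixed_vector P v \<longleftrightarrow> (\<forall>i. 0 < v $ i) \<and> transpose P *v v = v"

lemma chain_kernel_nonneg:
  assumes "stochastic_matrix P" and "0 \<le> \<alpha> i n" and "\<alpha> i n \<le> 1"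
  shows "0 \<le> chain_kernel P \<alpha> (i, n) y"
  using assms by (cases y) (auto simp: stochastic_matrix_def)

lemma chain_kernel_has_sum_1:
  fixes P :: "real ^ 'k::finite ^ 'k"
  assumes P: "stochastic_matrix P" "P $ i $ i = 0" and n: "1 \<le> n"
  shows "(chain_kernel P \<alpha> (i, n) has_sum 1) chain_states"
proof -
  define J where "J = (\<lambda>j. (j, 1 :: enat)) ` (UNIV - {i})"
  have "(\<Sum>y\<in>J. chain_kernel P \<alpha> (i, n) y)
      = (\<Sum>j\<in>UNIV - {i}. chain_kernel P \<alpha> (i, n) (j, 1))"
    unfolding J_def by (subst sum.reindex) (auto simp: inj_on_def)
  also have "\<dots> = (\<Sum>j\<in>UNIV - {i}. \<alpha> i n * P $ i $ j)"
    by (rule sum.cong) auto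
  also have "\<dots> = \<alpha> i n"
    using P by (simp add: stochastic_matrix_def sum_distrib_left[symmetric] sum_diff1)
  finally have J: "sum (chain_kernel P \<alpha> (i, n)) J = \<alpha> i n" .
  have "finite J" and "(i, n + 1) \<notin> J"
    by (auto simp: J_def)
  then have "sum (chain_kernel P \<alpha> (i, n)) (insert (i, n + 1) J) = 1"
    by (simp add: J)
  with \<open>finite J\<close> have "(chain_kernel P \<alpha> (i, n) has_sum 1) (insert (i, n + 1) J)"
    by (metis finite_insert has_sum_finite)
  moreover have "insert (i, n + 1) J \<subseteq> chain_states"
    using n by (auto simp: J_def chain_states_def intro: order_trans)
  moreover have "chain_kernel P \<alpha> (i, n) y = 0" if "y \<notin> insert (i, n + 1) J" for y
    using that by (cases y) (auto simp: J_def)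
  ultimately show ?thesis
    using has_sum_cong_neutral[of chain_states "insert (i, n + 1) J"
        "chain_kernel P \<alpha> (i, n)" "chain_kernel P \<alpha> (i, n)" 1] by blast
qed

end

theory Submission
  imports Defs
begin

text \<open>
  Call \<open>n\<close> the age of the state \<open>(i, n)\<close>, write \<open>\<P>\<^sub>i(n)\<close> for \<open>survival \<alpha> i n\<close> and
  \<open>u\<^sub>i = \<nu> (i, 1)\<close>. A state \<open>(i, n + 1)\<close> with \<open>n \<ge> 1\<close> can be entered only from \<open>(i, n)\<close>, so
  invariance forces \<open>\<nu> (i, n) = u\<^sub>i \<P>\<^sub>i(n)\<close>; and \<open>(i, \<infinity>)\<close> can be entered only from itself while
  leaking mass at a positive rate, so \<open>\<nu> (i, \<infinity>) = 0\<close>. What remains is the balance at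
  the states \<open>(i, 1)\<close>. The mass that leaves letter \<open>j\<close> from age \<open>n\<close> is
  \<open>u\<^sub>j \<P>\<^sub>j(n) \<alpha>\<^sub>j\<^sub>,\<^sub>n = u\<^sub>j \<P>\<^sub>j(n) - u\<^sub>j \<P>\<^sub>j(n + 1)\<close>, which telescopes to \<open>u\<^sub>j\<close> because the masses
  \<open>\<nu> (j, n)\<close> are summable and therefore tend to 0. Hence the balance at the states \<open>(i, 1)\<close> says
  exactly that \<open>u P = u\<close>. This description of the invariant probabilities is the lemma
  \<open>invariant_iff\<close>.

  By irreducibility a nonzero nonnegative solution of \<open>u P = u\<close> is positive, and by the Frobenius
  theorem it exists and is unique up to a factor. The total mass of \<open>\<nu>\<close> is
  \<open>\<Sum>\<^sub>i u\<^sub>i \<Theta>\<^sub>i\<close>. That this equals 1 with all \<open>u\<^sub>i > 0\<close> makes every \<open>\<Theta>\<^sub>i\<close> finite and determines the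
  factor, which gives uniqueness and the formula (\<open>invariant_formula\<close>); conversely, if all \<open>\<Theta>\<^sub>i\<close> are
  finite, the formula defines an invariant probability (\<open>invariant_exists\<close>).

  For a stochastic matrix the part of the Frobenius theorem that is used here is elementary: 1 is
  an eigenvalue of the transpose because it is one of \<open>P\<close>, and summing coordinates shows that the
  absolute values of an eigenvector form an eigenvector again.
\<close>

section \<open>Row vectors fixed by an irreducible stochastic matrix\<close>

lemma vector_matrix_mult_nth: "(x v* P) $ j = (\<Sum>i\<in>UNIV. x $ i * P $ i $ j)"
  for P :: "real ^ 'm ^ 'k::finite"
  by (simp add: vector_matrix_mult_def mult.commute)

lemma positive_fixed_vector_iff:
  "positive_fixed_vector P v \<longleftrightarrow> (\<forall>i. 0 < v $ i) \<and> v v* P = v"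
  for P :: "real ^ 'k::finite ^ 'k"
  by (simp add: positive_fixed_vector_def)

lemma matrix_funpow_nonneg:
  fixes P :: "real ^ 'k::finite ^ 'k"
  assumes "\<And>i j. 0 \<le> P $ i $ j"
  shows "0 \<le> (((**) P ^^ n) (mat 1)) $ i $ j"
proof (induction n arbitrary: i j)
  case 0
  then show ?case by (simp add: mat_def)
next
  case (Suc n)
  then show ?case
    by (auto simp: matrix_matrix_mult_def intro!: sum_nonneg mult_nonneg_nonneg assms)
qed

lemma fixed_vector_funpow:
  fixes P :: "real ^ 'k::finite ^ 'k"
  assumes "u v* P = u"
  shows "u v* (((**) P ^^ n) (mat 1)) = u"
proof (induction n)
  case (Suc n)
  have "u v* (((**) P ^^ Suc n) (mat 1)) = (u v* P) v* (((**) P ^^ n) (mat 1))"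
    by (simp add: vector_matrix_mul_assoc)
  then show ?case by (simp add: assms Suc)
qed (simp add: vector_matrix_mul_rid)

text \<open>A positive coordinate \<open>i\<close> spreads to every \<open>j\<close>: since \<open>u = u P\<^sup>n\<close> for all \<open>n\<close>, the coordinate \<open>j\<close> of \<open>u\<close>
  is at least \<open>u\<^sub>i\<close> times the entry \<open>(i, j)\<close> of \<open>P\<^sup>n\<close>, and irreducibility makes that entry positive for
  some \<open>n\<close>.\<close>

lemma nonneg_fixed_vector_positive:
  fixes P :: "real ^ 'k::finite ^ 'k"
  assumes P: "stochastic_matrix P" "irreducible_matrix P"
    and u: "u v* P = u" "\<And>i. 0 \<le> u $ i" "u \<noteq> 0"
  shows "0 < u $ j"
proof -
  obtain i where i: "0 < u $ i"
    using u(2,3) by (metis order_le_less vec_eq_iff zero_index)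
  obtain n where n: "0 < (((**) P ^^ n) (mat 1)) $ i $ j" (is "0 < ?M $ i $ j")
    using P(2) by (auto simp: irreducible_matrix_def)
  have "0 < u $ i * ?M $ i $ j"
    using i n by simp
  also have "\<dots> \<le> (\<Sum>i\<in>UNIV. u $ i * ?M $ i $ j)"
    using P(1) u(2)
    by (intro member_le_sum) (auto intro!: mult_nonneg_nonneg matrix_funpow_nonneg
        simp: stochastic_matrix_def)
  also have "\<dots> = u $ j"
    using fixed_vector_funpow[OF u(1), of n] by (metis vector_matrix_mult_nth)
  finally show ?thesis .
qed

text \<open>Mass conservation, which turns a coordinatewise inequality between \<open>u\<close> and \<open>u P\<close> into an equality.\<close>

lemma sum_vector_stochastic_matrix:
  fixes P :: "real ^ 'k::finite ^ 'k"
  assumes "stochastic_matrix P"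
  shows "(\<Sum>j\<in>UNIV. (x v* P) $ j) = (\<Sum>i\<in>UNIV. x $ i)"
proof -
  have "(\<Sum>j\<in>UNIV. (x v* P) $ j) = (\<Sum>i\<in>UNIV. \<Sum>j\<in>UNIV. x $ i * P $ i $ j)"
    unfolding vector_matrix_mult_nth by (rule sum.swap)
  also have "\<dots> = (\<Sum>i\<in>UNIV. x $ i)"
    using assms by (simp add: sum_distrib_left[symmetric] stochastic_matrix_def)
  finally show ?thesis .
qed

text \<open>The rows of \<open>P\<close> sum to 1, so the all-ones vector is in the kernel of \<open>P - 1\<close>. A square matrix
  and its transpose are singular together, which yields a kernel vector on the other side.\<close>

lemma stochastic_matrix_fixed_vector:
  fixes P :: "real ^ 'k::finite ^ 'k"
  assumes "stochastic_matrix P"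
  obtains x where "x v* P = x" "x \<noteq> 0"
proof -
  define A where "A = P - mat 1"
  have "P *v 1 = 1"
    using assms by (simp add: vec_eq_iff matrix_vector_mult_def stochastic_matrix_def)
  then have "A *v 1 = 0"
    by (simp add: A_def matrix_vector_mult_diff_rdistrib)
  moreover have "(1 :: real ^ 'k) \<noteq> 0"
    by simp
  ultimately have "\<not> (\<exists>B. B ** A = mat 1)"
    unfolding matrix_left_invertible_ker by blast
  then have "\<not> (\<exists>B. B ** transpose A = mat 1)"
    by (metis left_invertible_transpose matrix_left_right_inverse)
  then obtain x where "transpose A *v x = 0" "x \<noteq> 0"
    unfolding matrix_left_invertible_ker by blast
  then have "x v* P = x"
    by (simp add: A_def vector_matrix_mult_diff_rdistrib vector_matrix_mul_rid)
  with \<open>x \<noteq> 0\<close> show thesis by (rule that[rotated])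
qed

text \<open>If \<open>x P = x\<close>, the triangle inequality gives \<open>\<bar>x\<bar> \<le> \<bar>x\<bar> P\<close> in every coordinate. Both sides have the same
  coordinate sum, so \<open>\<bar>x\<bar>\<close> is fixed as well, and irreducibility makes it positive.\<close>

lemma positive_fixed_vector_exists:
  fixes P :: "real ^ 'k::finite ^ 'k"
  assumes "stochastic_matrix P" "irreducible_matrix P"
  shows "\<exists>v. positive_fixed_vector P v"
proof -
  obtain x where x: "x v* P = x" "x \<noteq> 0"
    using stochastic_matrix_fixed_vector[OF assms(1)] by blast
  define u :: "real ^ 'k" where "u = (\<chi> i. \<bar>x $ i\<bar>)"
  have le: "u $ j \<le> (u v* P) $ j" for j
  proof -
    have "u $ j = \<bar>\<Sum>i\<in>UNIV. x $ i * P $ i $ j\<bar>"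
      using x(1) by (simp add: u_def flip: vector_matrix_mult_nth)
    also have "\<dots> \<le> (\<Sum>i\<in>UNIV. \<bar>x $ i * P $ i $ j\<bar>)"
      by (rule sum_abs)
    also have "\<dots> = (u v* P) $ j"
      using assms(1) by (simp add: vector_matrix_mult_nth u_def abs_mult stochastic_matrix_def)
    finally show ?thesis .
  qed
  have "(\<Sum>j\<in>UNIV. (u v* P) $ j - u $ j) = 0"
    by (simp add: sum_subtractf sum_vector_stochastic_matrix[OF assms(1)])
  then have "u v* P = u"
    using le by (simp add: sum_nonneg_eq_0_iff vec_eq_iff)
  moreover have "u \<noteq> 0"
    using x(2) by (auto simp: u_def vec_eq_iff)
  ultimately have "\<forall>i. 0 < u $ i"
    using nonneg_fixed_vector_positive[OF assms, of u] by (auto simp: u_def)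
  with \<open>u v* P = u\<close> show ?thesis
    by (auto simp: positive_fixed_vector_iff)
qed

text \<open>Subtract from \<open>w\<close> the largest multiple of \<open>v\<close> that keeps it nonnegative. The difference is fixed,
  and it vanishes in some coordinate, so by the strict positivity of nonzero nonnegative fixed
  vectors it is zero.\<close>

lemma positive_fixed_vector_unique:
  fixes P :: "real ^ 'k::finite ^ 'k"
  assumes P: "stochastic_matrix P" "irreducible_matrix P"
    and v: "positive_fixed_vector P v" and w: "positive_fixed_vector P w"
  shows "\<exists>c>0. w = c *\<^sub>R v"
proof -
  define c where "c = Min (range (\<lambda>i. w $ i / v $ i))"
  have "c \<in> range (\<lambda>i. w $ i / v $ i)"
    unfolding c_def by (rule Min_in) auto
  then obtain k where k: "c = w $ k / v $ k" by blast
  have pos: "0 < v $ i" "0 < w $ i" for i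
    using v w by (auto simp: positive_fixed_vector_iff)
  have "c \<le> w $ i / v $ i" for i
    unfolding c_def by (rule Min_le) auto
  then have nonneg: "0 \<le> (w - c *\<^sub>R v) $ i" for i
    using pos(1)[of i] by (simp add: pos_le_divide_eq[symmetric])
  have "(w - c *\<^sub>R v) v* P = w - c *\<^sub>R v"
    using v w by (simp add: positive_fixed_vector_iff vector_matrix_mult_diff_distrib
        scaleR_vector_matrix_assoc)
  moreover have "(w - c *\<^sub>R v) $ k = 0"
    using pos(1)[of k] by (simp add: k)
  ultimately have "w - c *\<^sub>R v = 0"
    using nonneg_fixed_vector_positive[OF P, of "w - c *\<^sub>R v" k] nonneg by force
  moreover have "0 < c"
    using pos by (simp add: k)
  ultimately show ?thesis by auto
qed

section \<open>Sums over the state space\<close>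

text \<open>The total mass and the inflow at age 1 are infinite sums over the states. Without mass at \<open>\<infinity>\<close>,
  such a sum is one ordinary series per letter; its index 0 stands for age 1.\<close>

lemma has_sum_chain_states:
  fixes f :: "'k::finite \<times> enat \<Rightarrow> real"
  assumes nonneg: "\<And>i n. 0 \<le> f (i, enat (Suc n))"
    and inf: "\<And>i. f (i, \<infinity>) = 0"
    and sums: "\<And>i. (\<lambda>n. f (i, enat (Suc n))) sums s i"
  shows "(f has_sum (\<Sum>i\<in>UNIV. s i)) chain_states"
proof -
  have "(f has_sum s i) ({i} \<times> {1..})" for i
  proof -
    have "((\<lambda>n. f (i, enat (Suc n))) has_sum s i) UNIV"
      using sums nonneg by (intro sums_nonneg_imp_has_sum) auto
    then have "(f has_sum s i) (range (\<lambda>n. (i, enat (Suc n))))"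
      by (subst has_sum_reindex) (auto simp: inj_on_def o_def)
    moreover have "x \<in> range (\<lambda>n. (i, enat (Suc n))) \<or> x = (i, \<infinity>)"
      if x: "x \<in> {i} \<times> {1..}" for x
    proof (cases "snd x")
      case (enat m)
      then have "x = (i, enat (Suc (m - 1)))"
        using x by (cases x) (auto simp: one_enat_def)
      then show ?thesis by blast
    qed (use x in auto)
    ultimately show ?thesis
      using inf
      by (subst has_sum_cong_neutral[where S = "{i} \<times> {1..}"
            and T = "range (\<lambda>n. (i, enat (Suc n)))" and g = f])
        (auto simp: one_enat_def)
  qed
  then have "(f has_sum (\<Sum>i\<in>UNIV. s i)) (\<Union>i\<in>UNIV. {i} \<times> {1..})"
    by (intro sum_has_sum) auto
  also have "(\<Union>i\<in>UNIV. {i} \<times> {1..}) = chain_states"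
    by (auto simp: chain_states_def)
  finally show ?thesis .
qed

lemma pmf_has_sum_1:
  assumes "set_pmf p \<subseteq> A"
  shows "(pmf p has_sum 1) A"
  using infsetsum_pmf_eq_1[OF assms] pmf_abs_summable[of p A]
  by (metis abs_summable_equivalent abs_summable_summable has_sum_infsum infsetsum_infsum)

text \<open>Passes from unconditional sums to the integral that the construction of a mass function uses.\<close>

lemma pmf_of_has_sum_1:
  fixes f :: "'a \<Rightarrow> real"
  assumes "\<And>x. 0 \<le> f x" "(f has_sum 1) A" "\<And>x. x \<notin> A \<Longrightarrow> f x = 0"
  obtains p where "pmf p = f"
proof -
  have sum: "(f has_sum 1) UNIV"
    using assms(2,3) has_sum_cong_neutral[of UNIV A f f 1] by auto
  then have "Infinite_Set_Sum.abs_summable_on f UNIV"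
    by (metis abs_summable_equivalent has_sum_imp_summable summable_on_iff_abs_summable_on_real)
  then have "(\<integral>\<^sup>+x. ennreal (f x) \<partial>count_space UNIV) = 1"
    using assms(1) sum by (simp add: nn_integral_conv_infsetsum infsetsum_infsum infsumI)
  then show thesis
    using that[of "embed_pmf f"] assms(1) by (simp add: pmf_embed_pmf fun_eq_iff)
qed

lemma has_sum_eq_iff: "(f has_sum s) A \<Longrightarrow> (f has_sum t) A \<longleftrightarrow> t = s"
  for f :: "'a \<Rightarrow> real"
  by (auto dest: has_sum_unique)

lemma summable_pmf_comp:
  fixes g :: "nat \<Rightarrow> 'a"
  assumes "inj g"
  shows "summable (\<lambda>n. pmf p (g n))"
proof -
  have "pmf p summable_on UNIV"
    using pmf_has_sum_1[of p UNIV] by (auto dest: has_sum_imp_summable)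
  then have "pmf p summable_on range g"
    by (rule summable_on_subset_banach) simp
  then have "(pmf p \<circ> g) summable_on UNIV"
    using assms by (simp add: summable_on_reindex)
  then show ?thesis
    by (auto simp: o_def dest: summable_on_imp_summable)
qed

section \<open>The chain and its balance equations\<close>

lemma enat_Suc_0: "enat (Suc 0) = 1"
  by (simp only: one_enat_def One_nat_def)

lemma survival_1 [simp]: "survival \<alpha> i (Suc 0) = 1"
  by (simp add: survival_def)

lemma survival_Suc: "1 \<le> n \<Longrightarrow> survival \<alpha> i (Suc n) = survival \<alpha> i n * (1 - \<alpha> i (enat n))"
  by (simp add: survival_def)

locale reset_chain =
  fixes P :: "real ^ 'k::finite ^ 'k"
    and \<alpha> :: "'k \<Rightarrow> enat \<Rightarrow> real"
  assumes stochastic: "stochastic_matrix P"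
    and irreducible: "irreducible_matrix P"
    and diagonal: "P $ i $ i = 0"
    and \<alpha>: "1 \<le> n \<Longrightarrow> 0 < \<alpha> i n \<and> \<alpha> i n < 1"
begin

abbreviation "invariant \<equiv> invariant_probability chain_states (chain_kernel P \<alpha>)"

lemma survival_pos: "0 < survival \<alpha> i n"
  using \<alpha> by (auto simp: survival_def one_enat_def intro!: prod_pos)

lemma Theta_finite_iff: "Theta \<alpha> i < \<infinity> \<longleftrightarrow> summable (\<lambda>n. survival \<alpha> i (Suc n))"
  using survival_pos[of i] unfolding Theta_def
  by (auto simp: suminf_ennreal2 less_imp_le less_top intro: summable_suminf_not_top)

lemma enn2real_Theta:
  assumes "Theta \<alpha> i < \<infinity>"
  shows "(\<lambda>n. survival \<alpha> i (Suc n)) sums enn2real (Theta \<alpha> i)"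
proof -
  have "summable (\<lambda>n. survival \<alpha> i (Suc n))"
    using assms Theta_finite_iff by blast
  moreover from this have "enn2real (Theta \<alpha> i) = (\<Sum>n. survival \<alpha> i (Suc n))"
    using survival_pos[of i] unfolding Theta_def
    by (simp add: suminf_ennreal2 less_imp_le suminf_nonneg)
  ultimately show ?thesis by (simp add: summable_sums)
qed

text \<open>The successor of an age determines the age, also for \<open>n = \<infinity>\<close>, where the statement says that \<open>(i, \<infinity>)\<close>
  is fed by itself alone.\<close>

lemma has_sum_inflow_Suc:
  assumes "1 \<le> n"
  shows "((\<lambda>x. f x * chain_kernel P \<alpha> x (i, n + 1)) has_sum f (i, n) * (1 - \<alpha> i n)) chain_states"
proof (rule has_sum_finite_neutralI[of "{(i, n)}"])
  fix x assume x: "x \<in> chain_states - {(i, n)}"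
  obtain j m where [simp]: "x = (j, m)" by (cases x)
  have "n + 1 = m + 1 \<longleftrightarrow> n = m" "n + 1 \<noteq> 1"
    using assms by (cases n; cases m; auto simp: one_enat_def)+
  with x show "f x * chain_kernel P \<alpha> x (i, n + 1) = 0" by auto
qed (use assms in \<open>auto simp: chain_states_def\<close>)

text \<open>The probability that an excursion at \<open>j\<close> ends at age \<open>n\<close> is the decrement of the survival function
  at \<open>n\<close>. Its series telescopes, so the outflow of \<open>j\<close> is all of \<open>u j\<close> as soon as no mass escapes
  to infinite age, which is the limit assumption.\<close>

lemma has_sum_inflow_1:
  assumes nonneg: "\<And>j. 0 \<le> u j"
    and inf: "\<And>j. f (j, \<infinity>) = 0"
    and f: "\<And>j n. 1 \<le> n \<Longrightarrow> f (j, enat n) = u j * survival \<alpha> j n"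
    and lim: "\<And>j. (\<lambda>n. u j * survival \<alpha> j n) \<longlonglongrightarrow> 0"
  shows "((\<lambda>x. f x * chain_kernel P \<alpha> x (i, 1)) has_sum (\<Sum>j\<in>UNIV. u j * P $ j $ i)) chain_states"
proof (rule has_sum_chain_states)
  fix j
  have Q: "chain_kernel P \<alpha> (j, enat (Suc n)) (i, 1) = \<alpha> j (enat (Suc n)) * P $ j $ i" for n
    using diagonal[of i] by (auto simp: one_enat_def)
  have \<alpha>_Suc: "0 < \<alpha> j (enat (Suc n))" for n
    using \<alpha>[of "enat (Suc n)" j] by (simp add: one_enat_def)
  show "0 \<le> f (j, enat (Suc n)) * chain_kernel P \<alpha> (j, enat (Suc n)) (i, 1)" for n
    unfolding Q using nonneg[of j] survival_pos[of j "Suc n"] \<alpha>_Suc[of n] stochastic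
    by (simp add: f stochastic_matrix_def)
  have step: "f (j, enat (Suc n)) * chain_kernel P \<alpha> (j, enat (Suc n)) (i, 1)
      = (u j * survival \<alpha> j (Suc n) - u j * survival \<alpha> j (Suc (Suc n))) * P $ j $ i" for n
    unfolding Q by (simp add: f survival_Suc algebra_simps)
  have "(\<lambda>n. u j * survival \<alpha> j (Suc n) - u j * survival \<alpha> j (Suc (Suc n)))
      sums (u j * survival \<alpha> j (Suc 0) - 0)"
    by (rule telescope_sums'[OF LIMSEQ_Suc[OF lim]])
  then show "(\<lambda>n. f (j, enat (Suc n)) * chain_kernel P \<alpha> (j, enat (Suc n)) (i, 1))
      sums (u j * P $ j $ i)"
    unfolding step by (auto dest: sums_mult2)
qed (simp add: inf)

text \<open>Invariance splits into three parts: the masses at \<open>\<infinity>\<close> vanish, the masses along each letter decay with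
  the survival function, and the masses at age 1 are a fixed vector of \<open>P\<close>. The third part can be
  extracted only after the first two, since they are what makes the inflow series telescope.\<close>

lemma invariant_iff:
  "invariant \<nu> \<longleftrightarrow> set_pmf \<nu> \<subseteq> chain_states
     \<and> (\<forall>i. pmf \<nu> (i, \<infinity>) = 0)
     \<and> (\<forall>i. \<forall>n\<ge>1. pmf \<nu> (i, enat n) = pmf \<nu> (i, 1) * survival \<alpha> i n)
     \<and> (\<forall>i. pmf \<nu> (i, 1) = (\<Sum>j\<in>UNIV. pmf \<nu> (j, 1) * P $ j $ i))"
  (is "_ \<longleftrightarrow> _ \<and> ?inf \<and> ?geo \<and> ?fix")
proof -
  let ?bal = "\<lambda>y. ((\<lambda>x. pmf \<nu> x * chain_kernel P \<alpha> x y) has_sum pmf \<nu> y) chain_states"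
  \<comment> \<open>The case \<open>n = \<infinity>\<close> yields the balance at \<open>\<infinity>\<close>, the finite \<open>n\<close> the recursion along a letter.\<close>
  have bal_Suc: "?bal (i, n + 1) \<longleftrightarrow> pmf \<nu> (i, n + 1) = pmf \<nu> (i, n) * (1 - \<alpha> i n)"
    if "1 \<le> n" for i n
    by (rule has_sum_eq_iff[OF has_sum_inflow_Suc[OF that]])
  have bal_inf: "(\<forall>i. ?bal (i, \<infinity>)) \<longleftrightarrow> ?inf"
  proof -
    have "?bal (i, \<infinity>) \<longleftrightarrow> pmf \<nu> (i, \<infinity>) = 0" for i
      using bal_Suc[of \<infinity> i] \<alpha>[of \<infinity> i] by (auto simp: algebra_simps)
    then show ?thesis by blast
  qed
  have bal_geo: "(\<forall>i. \<forall>n\<ge>1. ?bal (i, enat (Suc n))) \<longleftrightarrow> ?geo"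
  proof -
    have bal: "?bal (i, enat (Suc n))
        \<longleftrightarrow> pmf \<nu> (i, enat (Suc n)) = pmf \<nu> (i, enat n) * (1 - \<alpha> i (enat n))"
      if "1 \<le> n" for i n
      using bal_Suc[of "enat n" i] that by (simp add: one_enat_def)
    have "pmf \<nu> (i, enat n) = pmf \<nu> (i, 1) * survival \<alpha> i n"
      if "\<forall>i. \<forall>n\<ge>1. ?bal (i, enat (Suc n))" "1 \<le> n" for i n
      using that(2)
    proof (induction n rule: dec_induct)
      case (step n)
      then show ?case using that(1) bal[of n i] by (simp add: survival_Suc)
    qed (simp add: enat_Suc_0)
    moreover have "?bal (i, enat (Suc n))" if ?geo "1 \<le> n" for i n
      unfolding bal[OF that(2)] using that by (simp add: survival_Suc)
    ultimately show ?thesis by blast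
  qed
  have bal_1: "(\<forall>i. ?bal (i, 1)) \<longleftrightarrow> ?fix" if ?inf ?geo
  proof -
    have "(\<lambda>n. pmf \<nu> (j, 1) * survival \<alpha> j n) \<longlonglongrightarrow> 0" for j
    proof -
      have "summable (\<lambda>n. pmf \<nu> (j, enat (Suc n)))"
        by (rule summable_pmf_comp) (auto simp: inj_def)
      then have "(\<lambda>n. pmf \<nu> (j, enat (Suc n))) \<longlonglongrightarrow> 0"
        by (rule summable_LIMSEQ_zero)
      then show ?thesis
        using \<open>?geo\<close> by (subst filterlim_sequentially_Suc[symmetric]) simp
    qed
    then have "((\<lambda>x. pmf \<nu> x * chain_kernel P \<alpha> x (i, 1))
        has_sum (\<Sum>j\<in>UNIV. pmf \<nu> (j, 1) * P $ j $ i)) chain_states" for i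
      using that by (intro has_sum_inflow_1) auto
    from has_sum_eq_iff[OF this] show ?thesis by simp
  qed
  have "(\<forall>y\<in>chain_states. ?bal y) \<longleftrightarrow>
      (\<forall>i. ?bal (i, \<infinity>)) \<and> (\<forall>i. \<forall>n\<ge>1. ?bal (i, enat (Suc n))) \<and> (\<forall>i. ?bal (i, 1))"
  proof (intro iffI ballI)
    fix y :: "'k \<times> enat"
    assume y: "y \<in> chain_states" and
      bal: "(\<forall>i. ?bal (i, \<infinity>)) \<and> (\<forall>i. \<forall>n\<ge>1. ?bal (i, enat (Suc n))) \<and> (\<forall>i. ?bal (i, 1))"
    obtain i m where [simp]: "y = (i, m)" by (cases y)
    consider "m = \<infinity>" | "m = 1" | n where "m = enat (Suc n)" "1 \<le> n"
    proof (cases m)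
      case (enat l)
      show ?thesis
      proof (cases "l = 1")
        case False
        then show ?thesis
          using y enat that(3)[of "l - 1"] by (auto simp: chain_states_def one_enat_def)
      qed (use enat that(2) in \<open>simp add: enat_Suc_0\<close>)
    qed (use that(1) in simp)
    then show "?bal y"
      using bal by cases auto
  qed (auto simp: chain_states_def one_enat_def)
  then show ?thesis
    unfolding invariant_probability_def using bal_inf bal_geo bal_1 by blast
qed

section \<open>The invariant probability\<close>

text \<open>The age 1 masses form a fixed vector, nonzero because otherwise the total mass would vanish, hence
  positive. So the convergence of \<open>\<Sum>\<^sub>n u\<^sub>i \<P>\<^sub>i(n)\<close> passes to \<open>\<Theta>\<^sub>i\<close>, and the total mass 1 fixes the ratio
  between \<open>u\<close> and \<open>v\<close>.\<close>

lemma invariant_formula: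
  assumes inv: "invariant \<nu>" and v: "positive_fixed_vector P v"
  shows "Theta \<alpha> i < \<infinity>"
    and "pmf \<nu> (i, \<infinity>) = 0"
    and "1 \<le> n \<Longrightarrow> pmf \<nu> (i, enat n)
      = v $ i / (\<Sum>j\<in>UNIV. enn2real (Theta \<alpha> j) * v $ j) * survival \<alpha> i n"
proof -
  define u :: "real ^ 'k" where "u = (\<chi> i. pmf \<nu> (i, 1))"
  have u: "pmf \<nu> (i, 1) = u $ i" for i
    by (simp add: u_def)
  have supp: "set_pmf \<nu> \<subseteq> chain_states"
    and inf: "pmf \<nu> (i, \<infinity>) = 0"
    and geo: "1 \<le> n \<Longrightarrow> pmf \<nu> (i, enat n) = u $ i * survival \<alpha> i n"
    and bal: "u $ i = (\<Sum>j\<in>UNIV. u $ j * P $ j $ i)" for i n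
    using inv unfolding invariant_iff u by blast+
  have fixed: "u v* P = u"
    by (simp add: vec_eq_iff vector_matrix_mult_nth flip: bal)
  have summable: "summable (\<lambda>n. pmf \<nu> (i, enat (Suc n)))" for i
    by (rule summable_pmf_comp) (auto simp: inj_def)
  have "(pmf \<nu> has_sum (\<Sum>i\<in>UNIV. \<Sum>n. pmf \<nu> (i, enat (Suc n)))) chain_states"
    by (rule has_sum_chain_states) (auto simp: inf summable intro: summable_sums)
  then have mass: "(\<Sum>i\<in>UNIV. \<Sum>n. pmf \<nu> (i, enat (Suc n))) = 1"
    using pmf_has_sum_1[OF supp] has_sum_unique by blast
  then have "u \<noteq> 0"
    by (auto simp: geo)
  then have pos: "0 < u $ i" for i
    using nonneg_fixed_vector_positive[OF stochastic irreducible fixed] by (simp add: u_def)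
  have Theta: "Theta \<alpha> i < \<infinity>" for i
    using summable[of i] pos[of i] unfolding Theta_finite_iff
    by (simp add: geo summable_cmult_iff)
  have "(\<Sum>i\<in>UNIV. u $ i * enn2real (Theta \<alpha> i)) = 1"
    using mass sums_unique[OF sums_mult[OF enn2real_Theta[OF Theta]]] by (simp add: geo)
  moreover obtain c where "u = c *\<^sub>R v"
    using positive_fixed_vector_unique[OF stochastic irreducible v, of u] fixed pos
    by (auto simp: positive_fixed_vector_iff)
  ultimately have "c * (\<Sum>j\<in>UNIV. enn2real (Theta \<alpha> j) * v $ j) = 1"
    by (simp add: sum_distrib_left ac_simps)
  then have "c = 1 / (\<Sum>j\<in>UNIV. enn2real (Theta \<alpha> j) * v $ j)"
    by (metis nonzero_eq_divide_eq mult_zero_right zero_neq_one)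
  with \<open>u = c *\<^sub>R v\<close> show "1 \<le> n \<Longrightarrow> pmf \<nu> (i, enat n)
      = v $ i / (\<Sum>j\<in>UNIV. enn2real (Theta \<alpha> j) * v $ j) * survival \<alpha> i n"
    by (simp add: geo)
  show "Theta \<alpha> i < \<infinity>" "pmf \<nu> (i, \<infinity>) = 0"
    by (fact Theta inf)+
qed

lemma invariant_unique:
  assumes "invariant \<nu>" "invariant \<nu>'"
  shows "\<nu> = \<nu>'"
proof (rule pmf_eqI)
  fix x :: "'k \<times> enat"
  obtain v where v: "positive_fixed_vector P v"
    using positive_fixed_vector_exists[OF stochastic irreducible] by blast
  obtain i m where x: "x = (i, m)" by (cases x)
  consider "x \<notin> chain_states" | "m = \<infinity>" | n where "m = enat n" "1 \<le> n"
    using x by (cases m) (auto simp: chain_states_def one_enat_def)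
  then show "pmf \<nu> x = pmf \<nu>' x"
  proof cases
    case 1
    moreover have "set_pmf \<nu> \<subseteq> chain_states" "set_pmf \<nu>' \<subseteq> chain_states"
      using assms unfolding invariant_iff by blast+
    ultimately show ?thesis
      by (metis pmf_eq_0_set_pmf subsetD)
  next
    case 2
    then show ?thesis
      by (simp add: x invariant_formula(2)[OF _ v] assms)
  next
    case 3
    then show ?thesis
      using invariant_formula(3)[OF _ v] assms by (simp add: x)
  qed
qed

text \<open>The formula for the invariant probability is taken as a definition: finiteness of the \<open>\<Theta>\<^sub>i\<close> is
  what allows it to be normalised, and its shape matches the description of invariance.\<close>

lemma invariant_exists:
  assumes Theta: "\<And>i. Theta \<alpha> i < \<infinity>"
  shows "\<exists>\<nu>. invariant \<nu>"
proof -
  obtain v where v: "positive_fixed_vector P v"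
    using positive_fixed_vector_exists[OF stochastic irreducible] by blast
  then have pos: "0 < v $ i" for i
    by (simp add: positive_fixed_vector_iff)
  define D where "D = (\<Sum>j\<in>UNIV. enn2real (Theta \<alpha> j) * v $ j)"
  have "0 < enn2real (Theta \<alpha> i)" for i
    using suminf_pos[OF sums_summable[OF enn2real_Theta[OF Theta]] survival_pos]
    unfolding sums_unique[OF enn2real_Theta[OF Theta], symmetric] .
  then have "0 < D"
    unfolding D_def using pos by (intro sum_pos) auto
  \<comment> \<open>The type of ages contains 0, which is not a state and must carry no mass.\<close>
  define f where "f = (\<lambda>(i, m). case m of \<infinity> \<Rightarrow> 0
    | enat n \<Rightarrow> if n = 0 then 0 else v $ i / D * survival \<alpha> i n)"
  have f [simp]: "f (i, enat (Suc n)) = v $ i / D * survival \<alpha> i (Suc n)" "f (i, \<infinity>) = 0" for i n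
    by (simp_all add: f_def)
  have nonneg: "0 \<le> f x" for x
    using pos survival_pos \<open>0 < D\<close>
    by (auto simp: f_def less_imp_le split: prod.splits enat.splits)
  have "(f has_sum (\<Sum>i\<in>UNIV. v $ i / D * enn2real (Theta \<alpha> i))) chain_states"
  proof (rule has_sum_chain_states)
    show "(\<lambda>n. f (i, enat (Suc n))) sums (v $ i / D * enn2real (Theta \<alpha> i))" for i
      unfolding f by (intro sums_mult enn2real_Theta Theta)
  qed (rule nonneg, rule f)
  also have "(\<Sum>i\<in>UNIV. v $ i / D * enn2real (Theta \<alpha> i)) = D / D"
    unfolding D_def sum_divide_distrib by (simp add: mult.commute)
  finally have "(f has_sum 1) chain_states"
    using \<open>0 < D\<close> by simp
  moreover have outside: "f x = 0" if "x \<notin> chain_states" for x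
    using that by (auto simp: f_def chain_states_def one_enat_def split: prod.splits enat.splits)
  ultimately obtain \<nu> where \<nu>: "pmf \<nu> = f"
    using pmf_of_has_sum_1[of f chain_states] nonneg by blast
  have f_1: "f (i, 1) = v $ i / D" for i
    using f(1)[of i 0] unfolding enat_Suc_0 survival_1 by simp
  have "invariant \<nu>"
    unfolding invariant_iff
  proof (intro conjI allI impI)
    show "set_pmf \<nu> \<subseteq> chain_states"
      using outside by (auto simp: set_pmf_eq \<nu>)
    show "pmf \<nu> (i, enat n) = pmf \<nu> (i, 1) * survival \<alpha> i n" if "1 \<le> n" for i n
      unfolding \<nu> f_1 using that by (simp add: f_def)
    have "(\<Sum>j\<in>UNIV. v $ j * P $ j $ i) = v $ i" for i
      using v by (metis positive_fixed_vector_iff vector_matrix_mult_nth)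
    then show "pmf \<nu> (i, 1) = (\<Sum>j\<in>UNIV. pmf \<nu> (j, 1) * P $ j $ i)" for i
      unfolding \<nu> f_1 by (simp add: sum_divide_distrib[symmetric])
  qed (simp add: \<nu>)
  then show ?thesis by blast
qed

end

theorem proposition2p3:
  fixes P :: "real ^ 'k::finite ^ 'k"
    and \<alpha> :: "'k \<Rightarrow> enat \<Rightarrow> real"
  assumes "CARD('k) \<ge> 2"
    and "stochastic_matrix P"
    and "irreducible_matrix P"
    and "\<And>i. P $ i $ i = 0"
    and "\<And>i n. 1 \<le> n \<Longrightarrow> 0 < \<alpha> i n \<and> \<alpha> i n < 1"
  shows "((\<exists>\<nu>. invariant_probability chain_states (chain_kernel P \<alpha>) \<nu>)
             \<longleftrightarrow> (\<forall>i. Theta \<alpha> i < \<infinity>))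
       \<and> (\<forall>\<nu> \<nu>'. invariant_probability chain_states (chain_kernel P \<alpha>) \<nu>
             \<longrightarrow> invariant_probability chain_states (chain_kernel P \<alpha>) \<nu>' \<longrightarrow> \<nu> = \<nu>')
       \<and> (\<exists>v. positive_fixed_vector P v)
       \<and> (\<forall>v w. positive_fixed_vector P v \<longrightarrow> positive_fixed_vector P w
             \<longrightarrow> (\<exists>c>0. w = c *\<^sub>R v))
       \<and> (\<forall>\<nu> v. invariant_probability chain_states (chain_kernel P \<alpha>) \<nu>
             \<longrightarrow> positive_fixed_vector P v
             \<longrightarrow> (\<forall>i. pmf \<nu> (i, \<infinity>) = 0)
               \<and> (\<forall>i n. n \<ge> 1 \<longrightarrow> pmf \<nu> (i, enat n)
                    = v $ i / (\<Sum>j\<in>UNIV. enn2real (Theta \<alpha> j) * v $ j) * survival \<alpha> i n))"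
proof -
  interpret reset_chain P \<alpha>
    using assms by unfold_locales auto
  obtain v where v: "positive_fixed_vector P v"
    using positive_fixed_vector_exists[OF stochastic irreducible] by blast
  show ?thesis
    using invariant_formula[OF _ v] invariant_formula(2,3) invariant_exists invariant_unique v
      positive_fixed_vector_unique[OF stochastic irreducible]
    by (intro conjI) blast+
qed

end
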